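(* Let $S$ be a non-degenerate translation surface in Lorentz-Minkowski space $\mathbb{L}^3$ that is of linear Weingarten type, i.e. there exist real numbers $a,b,c$, not all zero, such that the mean curvature $H$ and the Gauss curvature $K$ of $S$ satisfy $aH+bK=c$ on $S$. Then $K$ is constant on $S$ or $H$ is constant on $S$.
   Context: $\mathbb{L}^3$ is the real vector space $\mathbb{R}^3$ endowed with the Lorentzian metric $\langle\cdot,\cdot\rangle=(dx)^2+(dy)^2-(dz)^2$, where $(x,y,z)$ are the canonical coordinates. Surfaces are smooth and connected. A surface $S$ immersed in $\mathbb{L}^3$ is non-degenerate if the induced metric on $S$ is non-degenerate; then the induced metric is either positive definite ($S$ is spacelike) or Lorentzian ($S$ is timelike). A translation surface in $\mathbb{L}^3$ is a surface that can be written locally as the graph, over one of the coordinate planes, of a function which is the sum of two smooth real functions, each of one of the two coordinates of that plane, i.e. locally $z=f(x)+g(y)$, or $y=f(x)+g(z)$, or $x=f(y)+g(z)$, with $f,g$ smooth functions on open intervals. Let $\{E,F,G\}$ and $\{e,\mathsf{f},\mathsf{g}\}$ be the coefficients of the first and second fundamental forms (with respect to $\langle\cdot,\cdot\rangle$ and a unit normal vector field $N$ orienting $S$, so that $e=\langle N,X_{uu}\rangle$, $\mathsf{f}=\langle N,X_{uv}\rangle$, $\mathsf{g}=\langle N,X_{vv}\rangle$ for a local parametrization $X(u,v)$). The mean curvature and the Gauss curvature of $S$ are $$H=\epsilon\,\frac12\,\frac{eG-2\mathsf{f}F+\mathsf{g}E}{EG-F^2},\qquad K=\epsilon\,\frac{e\mathsf{g}-\mathsf{f}^2}{EG-F^2},$$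 where $\epsilon=-1$ if $S$ is spacelike and $\epsilon=1$ if $S$ is timelike. *)

theory Defs
  imports "HOL-Analysis.Analysis"
begin

text \<open>Only meant for open \<open>S\<close>: all derivatives are taken in the full space.\<close>

primrec Ck_on :: "nat \<Rightarrow> 'a::euclidean_space set \<Rightarrow> ('a \<Rightarrow> 'b::real_normed_vector) \<Rightarrow> bool" where
  "Ck_on 0 S f \<longleftrightarrow> continuous_on S f"
| "Ck_on (Suc k) S f \<longleftrightarrow> (\<forall>x\<in>S. f differentiable (at x)) \<and>
     (\<forall>b\<in>Basis. Ck_on k S (\<lambda>x. frechet_derivative f (at x) b))"

definition smooth_on :: "'a::euclidean_space set \<Rightarrow> ('a \<Rightarrow> 'b::real_normed_vector) \<Rightarrow> bool" where
  "smooth_on S f \<longleftrightarrow> (\<forall>k. Ck_on k S f)"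

definition pd_u :: "(real \<times> real \<Rightarrow> real^3) \<Rightarrow> real \<times> real \<Rightarrow> real^3" where
  "pd_u X q = frechet_derivative X (at q) (1, 0)"

definition pd_v :: "(real \<times> real \<Rightarrow> real^3) \<Rightarrow> real \<times> real \<Rightarrow> real^3" where
  "pd_v X q = frechet_derivative X (at q) (0, 1)"

definition lorentz :: "real^3 \<Rightarrow> real^3 \<Rightarrow> real" where
  "lorentz v w = v$1 * w$1 + v$2 * w$2 - v$3 * w$3"

text \<open>
  A surface is a topological space \<open>S\<close> together with a map \<open>\<psi>\<close> of \<open>S\<close> into three-space. Its
  local parametrizations are the open topological embeddings \<open>\<phi>\<close> of plane open sets \<open>U\<close> into \<open>S\<close>
  for which \<open>\<psi> \<circ> \<phi>\<close> is a smooth immersion. No separate smooth structure has to be recorded: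
  by the inverse function theorem any two local parametrizations are smoothly compatible, and
  if \<open>\<psi>\<close> is a smooth immersion of a smooth surface they are exactly the inverses of its charts.
\<close>

definition local_param ::
    "'m topology \<Rightarrow> ('m \<Rightarrow> real^3) \<Rightarrow> (real \<times> real) set \<Rightarrow> (real \<times> real \<Rightarrow> 'm) \<Rightarrow> bool" where
  "local_param S \<psi> U \<phi> \<longleftrightarrow>
     open U \<and> embedding_map (top_of_set U) S \<phi> \<and> openin S (\<phi> ` U) \<and>
     smooth_on U (\<psi> \<circ> \<phi>) \<and> (\<forall>q\<in>U. inj (frechet_derivative (\<psi> \<circ> \<phi>) (at q)))"

definition immersed_surface :: "'m topology \<Rightarrow> ('m \<Rightarrow> real^3) \<Rightarrow> bool" where
  "immersed_surface S \<psi> \<longleftrightarrow>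
     connected_space S \<and> Hausdorff_space S \<and> second_countable S \<and>
     (\<forall>p\<in>topspace S. \<exists>U \<phi>. local_param S \<psi> U \<phi> \<and> p \<in> \<phi> ` U)"

definition tangent_plane :: "(real \<times> real \<Rightarrow> real^3) \<Rightarrow> real \<times> real \<Rightarrow> (real^3) set" where
  "tangent_plane X q = range (frechet_derivative X (at q))"

definition nondegenerate :: "'m topology \<Rightarrow> ('m \<Rightarrow> real^3) \<Rightarrow> bool" where
  "nondegenerate S \<psi> \<longleftrightarrow>
     (\<forall>U \<phi> q. local_param S \<psi> U \<phi> \<and> q \<in> U \<longrightarrow>
        (\<forall>v \<in> tangent_plane (\<psi> \<circ> \<phi>) q.
           (\<forall>w \<in> tangent_plane (\<psi> \<circ> \<phi>) q. lorentz v w = 0) \<longrightarrow> v = 0))"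

definition spacelike :: "'m topology \<Rightarrow> ('m \<Rightarrow> real^3) \<Rightarrow> bool" where
  "spacelike S \<psi> \<longleftrightarrow>
     (\<forall>U \<phi> q. local_param S \<psi> U \<phi> \<and> q \<in> U \<longrightarrow>
        (\<forall>v \<in> tangent_plane (\<psi> \<circ> \<phi>) q. v \<noteq> 0 \<longrightarrow> lorentz v v > 0))"

text \<open>A connected non-degenerate surface that is not spacelike is timelike.\<close>

definition causal_sign :: "'m topology \<Rightarrow> ('m \<Rightarrow> real^3) \<Rightarrow> real" where
  "causal_sign S \<psi> = (if spacelike S \<psi> then -1 else 1)"

text \<open>
  The normal field has \<open>\<langle>N, N\<rangle> = -1\<close> on a spacelike and \<open>\<langle>N, N\<rangle> = 1\<close> on a timelike surface.
  A continuous unit normal field of a smooth non-degenerate surface is smooth.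
\<close>

definition unit_normal_field :: "'m topology \<Rightarrow> ('m \<Rightarrow> real^3) \<Rightarrow> ('m \<Rightarrow> real^3) \<Rightarrow> bool" where
  "unit_normal_field S \<psi> N \<longleftrightarrow>
     continuous_map S euclidean N \<and>
     (\<forall>p\<in>topspace S. \<bar>lorentz (N p) (N p)\<bar> = 1) \<and>
     (\<forall>U \<phi> q. local_param S \<psi> U \<phi> \<and> q \<in> U \<longrightarrow>
        (\<forall>w \<in> tangent_plane (\<psi> \<circ> \<phi>) q. lorentz (N (\<phi> q)) w = 0))"

text \<open>
  Here \<open>\<epsilon>\<close> is the causal sign, \<open>X\<close> a parametrization, \<open>n\<close> a unit normal vector at \<open>X q\<close>, and
  \<open>l\<close>, \<open>m\<close>, \<open>k\<close> are the coefficients of the second fundamental form.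
\<close>

definition param_mean_curvature ::
    "real \<Rightarrow> (real \<times> real \<Rightarrow> real^3) \<Rightarrow> real^3 \<Rightarrow> real \<times> real \<Rightarrow> real" where
  "param_mean_curvature \<epsilon> X n q =
     (let E = lorentz (pd_u X q) (pd_u X q);
          F = lorentz (pd_u X q) (pd_v X q);
          G = lorentz (pd_v X q) (pd_v X q);
          l = lorentz n (pd_u (pd_u X) q);
          m = lorentz n (pd_v (pd_u X) q);
          k = lorentz n (pd_v (pd_v X) q)
      in \<epsilon> * (1/2) * ((l * G - 2 * m * F + k * E) / (E * G - F\<^sup>2)))"

definition param_gauss_curvature ::
    "real \<Rightarrow> (real \<times> real \<Rightarrow> real^3) \<Rightarrow> real^3 \<Rightarrow> real \<times> real \<Rightarrow> real" where
  "param_gauss_curvature \<epsilon> X n q =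
     (let E = lorentz (pd_u X q) (pd_u X q);
          F = lorentz (pd_u X q) (pd_v X q);
          G = lorentz (pd_v X q) (pd_v X q);
          l = lorentz n (pd_u (pd_u X) q);
          m = lorentz n (pd_v (pd_u X) q);
          k = lorentz n (pd_v (pd_v X) q)
      in \<epsilon> * ((l * k - m\<^sup>2) / (E * G - F\<^sup>2)))"

text \<open>
  The curvatures at \<open>p\<close> are the common values of these expressions over all local
  parametrizations around \<open>p\<close>.
\<close>

definition mean_curvature ::
    "'m topology \<Rightarrow> ('m \<Rightarrow> real^3) \<Rightarrow> ('m \<Rightarrow> real^3) \<Rightarrow> 'm \<Rightarrow> real" where
  "mean_curvature S \<psi> N p =
     (THE h. \<forall>U \<phi> q. local_param S \<psi> U \<phi> \<and> q \<in> U \<and> \<phi> q = p \<longrightarrow>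
        h = param_mean_curvature (causal_sign S \<psi>) (\<psi> \<circ> \<phi>) (N p) q)"

definition gauss_curvature ::
    "'m topology \<Rightarrow> ('m \<Rightarrow> real^3) \<Rightarrow> ('m \<Rightarrow> real^3) \<Rightarrow> 'm \<Rightarrow> real" where
  "gauss_curvature S \<psi> N p =
     (THE h. \<forall>U \<phi> q. local_param S \<psi> U \<phi> \<and> q \<in> U \<and> \<phi> q = p \<longrightarrow>
        h = param_gauss_curvature (causal_sign S \<psi>) (\<psi> \<circ> \<phi>) (N p) q)"

definition linear_weingarten ::
    "'m topology \<Rightarrow> ('m \<Rightarrow> real^3) \<Rightarrow> ('m \<Rightarrow> real^3) \<Rightarrow> bool" where
  "linear_weingarten S \<psi> N \<longleftrightarrow>
     (\<exists>a b c :: real. \<not> (a = 0 \<and> b = 0 \<and> c = 0) \<and>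
        (\<forall>p\<in>topspace S. a * mean_curvature S \<psi> N p + b * gauss_curvature S \<psi> N p = c))"

text \<open>Different points may require graphs over different coordinate planes.\<close>

definition translation_surface :: "'m topology \<Rightarrow> ('m \<Rightarrow> real^3) \<Rightarrow> bool" where
  "translation_surface S \<psi> \<longleftrightarrow>
     (\<forall>p\<in>topspace S. \<exists>(I :: real set) (J :: real set) (f :: real \<Rightarrow> real) (g :: real \<Rightarrow> real) \<phi>.
        open I \<and> is_interval I \<and> open J \<and> is_interval J \<and> smooth_on I f \<and> smooth_on J g \<and>
        local_param S \<psi> (I \<times> J) \<phi> \<and> p \<in> \<phi> ` (I \<times> J) \<and>
        ((\<forall>s\<in>I. \<forall>t\<in>J. \<psi> (\<phi> (s, t)) = vector [s, t, f s + g t]) \<or>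
         (\<forall>s\<in>I. \<forall>t\<in>J. \<psi> (\<phi> (s, t)) = vector [s, f s + g t, t]) \<or>
         (\<forall>s\<in>I. \<forall>t\<in>J. \<psi> (\<phi> (s, t)) = vector [f s + g t, s, t])))"

end

theory Submission
  imports Defs "HOL-Computational_Algebra.Polynomial"
begin

text \<open>
  Write the surface near a point as the graph of \<open>f(s) + g(t)\<close> and put, up to signs,
  \<open>x = f'(s)\<^sup>2\<close>, \<open>y = g'(t)\<^sup>2\<close>, \<open>P = 1/f''(s)\<close>, \<open>Q = 1/g''(t)\<close>, where \<open>f'' g'' \<noteq> 0\<close>. The relation
  \<open>a H + b K = c\<close> becomes
  \<open>A R ((1 - x) P + (1 - y) Q) = B + C (1 - x - y)\<^sup>2 P Q\<close> with \<open>R\<^sup>2 = \<plusminus> (1 - x - y)\<close>, where \<open>A\<close> and \<open>B\<close>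
  are nonzero multiples of \<open>a\<close> and \<open>b\<close>. For two values of \<open>y\<close>, eliminating \<open>P\<close> leaves an identity in \<open>x\<close> that is linear
  in each of the two square roots. Multiplying all its conjugates gives a polynomial in \<open>x\<close> with infinitely
  many zeros, and evaluating it at the branch points leads to a contradiction. Hence \<open>K = 0\<close> whenever
  \<open>a\<close> and \<open>b\<close> are both nonzero.
\<close>

section \<open>Elimination from the separated relation\<close>

text \<open>The left-hand side is the product of the four conjugates under \<open>r1 \<mapsto> -r1\<close> and \<open>r2 \<mapsto> -r2\<close>.\<close>

lemma conjugate_product_zero:
  fixes a0 a1 a2 a3 r1 r2 w1 w2 :: real
  assumes "a0 + a1 * r1 + a2 * r2 + a3 * r1 * r2 = 0" "r1\<^sup>2 = w1" "r2\<^sup>2 = w2"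
  shows "(a0\<^sup>2 + a1\<^sup>2 * w1 - w2 * (a2\<^sup>2 + a3\<^sup>2 * w1))\<^sup>2 - 4 * w1 * (a0 * a1 - a2 * a3 * w2)\<^sup>2 = 0"
proof -
  have "(a0\<^sup>2 + a1\<^sup>2 * r1\<^sup>2 - r2\<^sup>2 * (a2\<^sup>2 + a3\<^sup>2 * r1\<^sup>2))\<^sup>2 - 4 * r1\<^sup>2 * (a0 * a1 - a2 * a3 * r2\<^sup>2)\<^sup>2
    = (a0 + a1 * r1 + a2 * r2 + a3 * r1 * r2) * (a0 + a1 * r1 - a2 * r2 - a3 * r1 * r2)
      * (a0 - a1 * r1 + a2 * r2 - a3 * r1 * r2) * (a0 - a1 * r1 - a2 * r2 + a3 * r1 * r2)"
    by algebra
  then show ?thesis using assms by simp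
qed

text \<open>At the branch point \<open>x = 1 - y1\<close> the conjugate product degenerates to the
  square of \<open>a0\<^sup>2 - s * (y1 - y2) * a2\<^sup>2\<close>. Its vanishing exhibits
  \<open>s * (y1 - y2) * a2\<^sup>2\<close> as a square, and \<open>a2\<close> is nonzero there. The
  same \<open>P\<close> must solve both equations for a given \<open>x\<close>, which is what allows
  its elimination.\<close>

lemma separated_relation_sign:
  fixes A b c s y1 y2 Q1 Q2 :: real
  assumes X: "infinite X"
    and rel: "\<And>x. x \<in> X \<Longrightarrow> \<exists>P R1 R2.
        R1\<^sup>2 = s * (1 - x - y1) \<and> R2\<^sup>2 = s * (1 - x - y2) \<and>
        A * R1 * ((1 - x) * P + (1 - y1) * Q1) = b + c * (1 - x - y1)\<^sup>2 * P * Q1 \<and>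
        A * R2 * ((1 - x) * P + (1 - y2) * Q2) = b + c * (1 - x - y2)\<^sup>2 * P * Q2"
    and nz: "A \<noteq> 0" "b \<noteq> 0" "y1 \<noteq> 0"
  shows "s * (y1 - y2) \<ge> 0"
proof -
  define w :: "real \<Rightarrow> real poly" where "w y = [:1 - y, -1:]" for y
  define v :: "real poly" where "v = [:1, -1:]"
  \<comment> \<open>Both equations are linear in \<open>P\<close>. Cross-multiplying them removes
    \<open>P\<close> and leaves \<open>a0 + a1 * R1 + a2 * R2 + a3 * R1 * R2 = 0\<close>, with these
    coefficients polynomial in \<open>x\<close>.\<close>
  define a0 where "a0 = smult (b * c) (smult Q1 ((w y1)\<^sup>2) - smult Q2 ((w y2)\<^sup>2))"
  define a1 where "a1 = smult (c * A * (1 - y1) * Q1 * Q2) ((w y2)\<^sup>2) - smult (b * A) v"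
  define a2 where "a2 = smult (b * A) v - smult (c * A * (1 - y2) * Q2 * Q1) ((w y1)\<^sup>2)"
  define a3 where "a3 = smult (A\<^sup>2 * ((1 - y2) * Q2 - (1 - y1) * Q1)) v"
  \<comment> \<open>This is the conjugate product for \<open>w1 = s * w y1\<close> and
    \<open>w2 = s * w y2\<close>, so it contains no square roots.\<close>
  define n where "n = (a0\<^sup>2 + a1\<^sup>2 * smult s (w y1) - smult s (w y2) * (a2\<^sup>2 + a3\<^sup>2 * smult s (w y1)))\<^sup>2
      - smult (4 * s) (w y1) * (a0 * a1 - a2 * a3 * smult s (w y2))\<^sup>2"
  have w [simp]: "poly (w y) x = 1 - x - y" and v [simp]: "poly v x = 1 - x" for x y
    by (simp_all add: w_def v_def)
  have "poly n x = 0" if x: "x \<in> X" for x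
  proof -
    obtain P R1 R2 where R: "R1\<^sup>2 = s * (1 - x - y1)" "R2\<^sup>2 = s * (1 - x - y2)"
      and e1: "A * R1 * ((1 - x) * P + (1 - y1) * Q1) = b + c * (1 - x - y1)\<^sup>2 * P * Q1"
      and e2: "A * R2 * ((1 - x) * P + (1 - y2) * Q2) = b + c * (1 - x - y2)\<^sup>2 * P * Q2"
      using rel[OF x] by blast
    have "poly a0 x + poly a1 x * R1 + poly a2 x * R2 + poly a3 x * R1 * R2 = 0"
      unfolding a0_def a1_def a2_def a3_def using e1 e2 by simp algebra
    from conjugate_product_zero[OF this R] show ?thesis
      unfolding n_def by (simp add: ac_simps)
  qed
  then have "X \<subseteq> {x. poly n x = 0}" by blast
  then have "n = 0" using X poly_roots_finite finite_subset by blast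
  \<comment> \<open>Since \<open>n\<close> vanishes identically, it may be evaluated outside
    \<open>X\<close>, even where no real \<open>R1\<close>, \<open>R2\<close> are given. At this
    point \<open>w y1\<close> is zero and \<open>w y2\<close> equals \<open>y1 - y2\<close>.\<close>
  then have "poly n (1 - y1) = 0" by simp
  then have "(poly a0 (1 - y1))\<^sup>2 = s * (y1 - y2) * (poly a2 (1 - y1))\<^sup>2"
    by (simp add: n_def)
  moreover have "poly a2 (1 - y1) = b * A * y1" by (simp add: a2_def)
  ultimately have "s * (y1 - y2) * (b * A * y1)\<^sup>2 \<ge> 0" by (metis zero_le_power2)
  then show ?thesis using nz by (auto simp: zero_le_mult_iff)
qed

text \<open>The hypotheses are symmetric under exchanging the indices 1 and 2, so the sign
  inequality holds in both directions.\<close>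

lemma no_separated_relation:
  fixes A b c s y1 y2 Q1 Q2 :: real
  assumes X: "infinite X"
    and rel: "\<And>x. x \<in> X \<Longrightarrow> \<exists>P R1 R2.
        R1\<^sup>2 = s * (1 - x - y1) \<and> R2\<^sup>2 = s * (1 - x - y2) \<and>
        A * R1 * ((1 - x) * P + (1 - y1) * Q1) = b + c * (1 - x - y1)\<^sup>2 * P * Q1 \<and>
        A * R2 * ((1 - x) * P + (1 - y2) * Q2) = b + c * (1 - x - y2)\<^sup>2 * P * Q2"
    and nz: "A \<noteq> 0" "b \<noteq> 0" "s \<noteq> 0" "y1 \<noteq> 0" "y2 \<noteq> 0"
  shows "y1 = y2"
proof -
  have "s * (y1 - y2) \<ge> 0" by (rule separated_relation_sign[OF X rel]) (use nz in auto)
  moreover have "s * (y2 - y1) \<ge> 0"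
    by (rule separated_relation_sign[OF X, of s y2 y1 A Q2 b c Q1]) (use rel nz in blast)+
  ultimately show ?thesis using nz by (auto simp: zero_le_mult_iff)
qed

section \<open>The Lorentzian metric in permuted axes\<close>

text \<open>Diagonal entries of the metric. Carrying them as signs lets a single computation serve
  graphs over all three coordinate planes.\<close>

definition lorentz_sign :: "3 \<Rightarrow> real" where
  "lorentz_sign m = (if m = 3 then -1 else 1)"

lemma lorentz_sign_sq: "(lorentz_sign m)\<^sup>2 = 1"
  by (simp add: lorentz_sign_def)

lemma axes_cases:
  assumes "distinct [i, j, k :: 3]"
  shows "UNIV = {i, j, k}"
proof -
  have "card {i, j, k} = CARD(3)" using assms by simp
  then show ?thesis by (metis card_subset_eq finite subset_UNIV)
qed

lemma lorentz_axes:
  assumes "distinct [i, j, k]"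
  shows "lorentz v w = lorentz_sign i * (v$i * w$i) + lorentz_sign j * (v$j * w$j)
    + lorentz_sign k * (v$k * w$k)"
proof -
  have "lorentz v w = (\<Sum>m\<in>UNIV. lorentz_sign m * (v$m * w$m))"
    by (simp add: lorentz_def sum_3 lorentz_sign_def)
  also have "\<dots> = (\<Sum>m\<in>{i, j, k}. lorentz_sign m * (v$m * w$m))"
    by (simp only: axes_cases[OF assms])
  finally show ?thesis using assms by simp
qed

lemma lorentz_sign_prod:
  assumes "distinct [i, j, k]"
  shows "lorentz_sign i * lorentz_sign j * lorentz_sign k = -1"
proof -
  have "(\<Prod>m\<in>UNIV. lorentz_sign m) = -1" by (simp add: prod_3 lorentz_sign_def)
  then have "(\<Prod>m\<in>{i, j, k}. lorentz_sign m) = -1" by (simp only: axes_cases[OF assms])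
  then show ?thesis using assms by (simp add: mult.assoc)
qed

section \<open>Derivatives of smooth maps\<close>

lemma smooth_onD:
  assumes "smooth_on U F" "x \<in> U"
  shows "F differentiable (at x)"
proof -
  have "Ck_on (Suc 0) U F" using assms(1) unfolding smooth_on_def by blast
  then show ?thesis using assms(2) by simp
qed

lemma smooth_on_partial:
  assumes "smooth_on U F" "b \<in> Basis"
  shows "smooth_on U (\<lambda>x. frechet_derivative F (at x) b)"
proof -
  have "Ck_on (Suc n) U F" for n using assms(1) unfolding smooth_on_def by blast
  then show ?thesis using assms(2) by (simp add: smooth_on_def)
qed

lemma smooth_on_has_real_derivative:
  fixes f :: "real \<Rightarrow> real"
  assumes "smooth_on I f" "x \<in> I"
  shows "(f has_real_derivative frechet_derivative f (at x) 1) (at x)"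
proof -
  have "(f has_derivative frechet_derivative f (at x)) (at x)"
    using smooth_onD[OF assms] frechet_derivative_works by blast
  moreover have "h * frechet_derivative f (at x) 1 = frechet_derivative f (at x) h" for h
    using linear_scale[OF linear_frechet_derivative[OF smooth_onD[OF assms]], of h 1] by simp
  ultimately show ?thesis by (rule has_derivative_imp_has_field_derivative)
qed

lemma smooth_on_real_derivatives:
  fixes f :: "real \<Rightarrow> real"
  assumes "smooth_on I f"
  obtains f1 f2 where "\<And>x. x \<in> I \<Longrightarrow> (f has_real_derivative f1 x) (at x)"
    "\<And>x. x \<in> I \<Longrightarrow> (f1 has_real_derivative f2 x) (at x)" "continuous_on I f2"
proof
  define D :: "(real \<Rightarrow> real) \<Rightarrow> real \<Rightarrow> real" where "D h = (\<lambda>x. frechet_derivative h (at x) 1)" for h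
  have s: "smooth_on I (D h)" if "smooth_on I h" for h
    using smooth_on_partial[OF that, of 1] by (simp add: D_def)
  show "(f has_real_derivative D f x) (at x)" if "x \<in> I" for x
    unfolding D_def by (rule smooth_on_has_real_derivative[OF assms that])
  show "(D f has_real_derivative D (D f) x) (at x)" if "x \<in> I" for x
    using smooth_on_has_real_derivative[OF s[OF assms] that] by (simp add: D_def)
  show "continuous_on I (D (D f))"
    using s[OF s[OF assms]] unfolding smooth_on_def by (auto dest: spec[of _ 0])
qed

lemma smooth_on_component_has_derivative:
  fixes Y :: "'a::euclidean_space \<Rightarrow> real^'n"
  assumes "smooth_on U Y" "q \<in> U"
  shows "((\<lambda>z. Y z $ i) has_derivative (\<lambda>h. frechet_derivative Y (at q) h $ i)) (at q)"
proof -
  have "(Y has_derivative frechet_derivative Y (at q)) (at q)"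
    using smooth_onD[OF assms] frechet_derivative_works by blast
  then show ?thesis by (rule bounded_linear.has_derivative[OF bounded_linear_vec_nth])
qed

lemma smooth_on_subset: "smooth_on U F \<Longrightarrow> V \<subseteq> U \<Longrightarrow> smooth_on V F"
proof -
  have "Ck_on n U F \<Longrightarrow> V \<subseteq> U \<Longrightarrow> Ck_on n V F" for n
    by (induction n arbitrary: F) (auto intro: continuous_on_subset)
  then show "smooth_on U F \<Longrightarrow> V \<subseteq> U \<Longrightarrow> smooth_on V F"
    by (simp add: smooth_on_def)
qed

lemma has_derivative_unique_on_open:
  assumes "open V" "q \<in> V" "\<And>z. z \<in> V \<Longrightarrow> F z = G z"
    and "(F has_derivative F') (at q)" "(G has_derivative G') (at q)"
  shows "F' h = G' h"
proof -
  have "(G has_derivative F') (at q)"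
    using has_derivative_transform_within_open[OF assms(4,1,2)] assms(3) by blast
  then show ?thesis using assms(5) has_derivative_unique by blast
qed

section \<open>Curvatures of a graph in an arbitrary parametrization\<close>

text \<open>
  In the following formulas \<open>p, q, x, y\<close> stand for \<open>f'\<close>, \<open>g'\<close>, \<open>f''\<close>, \<open>g''\<close>, and \<open>n\<close> for
  the \<open>k\<close>-th component of the unit normal vector.
\<close>

definition graph_det :: "3 \<Rightarrow> 3 \<Rightarrow> 3 \<Rightarrow> real \<Rightarrow> real \<Rightarrow> real" where
  "graph_det i j k p q = lorentz_sign i * lorentz_sign j
     + lorentz_sign k * (lorentz_sign i * q\<^sup>2 + lorentz_sign j * p\<^sup>2)"

definition graph_mean_curvature ::
    "3 \<Rightarrow> 3 \<Rightarrow> 3 \<Rightarrow> real \<Rightarrow> real \<Rightarrow> real \<Rightarrow> real \<Rightarrow> real \<Rightarrow> real \<Rightarrow> real" where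
  "graph_mean_curvature i j k \<epsilon> n p q x y = \<epsilon> * (1/2) * (lorentz_sign k * n *
     (x * (lorentz_sign j + lorentz_sign k * q\<^sup>2) + y * (lorentz_sign i + lorentz_sign k * p\<^sup>2))
     / graph_det i j k p q)"

definition graph_gauss_curvature ::
    "3 \<Rightarrow> 3 \<Rightarrow> 3 \<Rightarrow> real \<Rightarrow> real \<Rightarrow> real \<Rightarrow> real \<Rightarrow> real \<Rightarrow> real \<Rightarrow> real" where
  "graph_gauss_curvature i j k \<epsilon> n p q x y = \<epsilon> * (n\<^sup>2 * x * y / graph_det i j k p q)"

text \<open>
  Any local parametrization \<open>Y\<close> near a point of the graph satisfies \<open>Y\<^sub>k = f(Y\<^sub>i) + g(Y\<^sub>j)\<close>, so its
  curvatures can be computed without inverting a chart. This makes the definite descriptions of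
  \<open>mean_curvature\<close> and \<open>gauss_curvature\<close> well defined.
\<close>

locale graph_near =
  fixes i j k :: 3 and V :: "(real \<times> real) set" and Y :: "real \<times> real \<Rightarrow> real^3"
    and I J :: "real set" and f f1 f2 g g1 g2 :: "real \<Rightarrow> real"
  assumes axes: "distinct [i, j, k]"
    and V: "open V" and smooth: "smooth_on V Y"
    and dom: "\<And>z. z \<in> V \<Longrightarrow> Y z $ i \<in> I" "\<And>z. z \<in> V \<Longrightarrow> Y z $ j \<in> J"
    and graph: "\<And>z. z \<in> V \<Longrightarrow> Y z $ k = f (Y z $ i) + g (Y z $ j)"
    and f1: "\<And>x. x \<in> I \<Longrightarrow> (f has_real_derivative f1 x) (at x)"
    and f2: "\<And>x. x \<in> I \<Longrightarrow> (f1 has_real_derivative f2 x) (at x)"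
    and g1: "\<And>x. x \<in> J \<Longrightarrow> (g has_real_derivative g1 x) (at x)"
    and g2: "\<And>x. x \<in> J \<Longrightarrow> (g1 has_real_derivative g2 x) (at x)"
begin

lemma frechet_derivative_graph:
  assumes q: "q \<in> V"
  shows "frechet_derivative Y (at q) h $ k =
    f1 (Y q $ i) * frechet_derivative Y (at q) h $ i + g1 (Y q $ j) * frechet_derivative Y (at q) h $ j"
proof -
  note Yd = smooth_on_component_has_derivative[OF smooth q]
  note fd = DERIV_compose_FDERIV[OF f1[OF dom(1)[OF q]] Yd]
  note gd = DERIV_compose_FDERIV[OF g1[OF dom(2)[OF q]] Yd]
  from has_derivative_unique_on_open[OF V q graph Yd has_derivative_add[OF fd gd], of h]
  show ?thesis by (simp add: mult.commute)
qed

lemma second_derivative_graph: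
  assumes q: "q \<in> V" and b: "b \<in> Basis"
  defines "Z \<equiv> \<lambda>z. frechet_derivative Y (at z) b"
  shows "frechet_derivative Z (at q) h $ k =
    f2 (Y q $ i) * Z q $ i * frechet_derivative Y (at q) h $ i + f1 (Y q $ i) * frechet_derivative Z (at q) h $ i
    + g2 (Y q $ j) * Z q $ j * frechet_derivative Y (at q) h $ j + g1 (Y q $ j) * frechet_derivative Z (at q) h $ j"
proof -
  have sZ: "smooth_on V Z" unfolding Z_def by (rule smooth_on_partial[OF smooth b])
  note Yd = smooth_on_component_has_derivative[OF smooth q]
  note Zd = smooth_on_component_has_derivative[OF sZ q]
  note fd = DERIV_compose_FDERIV[OF f2[OF dom(1)[OF q]] Yd]
  note gd = DERIV_compose_FDERIV[OF g2[OF dom(2)[OF q]] Yd]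
  have eq: "Z z $ k = f1 (Y z $ i) * Z z $ i + g1 (Y z $ j) * Z z $ j" if "z \<in> V" for z
    unfolding Z_def by (rule frechet_derivative_graph[OF that])
  from has_derivative_unique_on_open[OF V q eq Zd
      has_derivative_add[OF has_derivative_mult[OF fd Zd] has_derivative_mult[OF gd Zd]], of h]
  show ?thesis by (simp add: algebra_simps)
qed

lemma pd_k:
  assumes "q \<in> V"
  shows "pd_u Y q $ k = f1 (Y q $ i) * pd_u Y q $ i + g1 (Y q $ j) * pd_u Y q $ j"
    and "pd_v Y q $ k = f1 (Y q $ i) * pd_v Y q $ i + g1 (Y q $ j) * pd_v Y q $ j"
  unfolding pd_u_def pd_v_def by (rule frechet_derivative_graph[OF assms])+

lemma pd_pd_k:
  assumes "q \<in> V"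
  shows "pd_u (pd_u Y) q $ k = f2 (Y q $ i) * pd_u Y q $ i * pd_u Y q $ i
      + f1 (Y q $ i) * pd_u (pd_u Y) q $ i
      + g2 (Y q $ j) * pd_u Y q $ j * pd_u Y q $ j + g1 (Y q $ j) * pd_u (pd_u Y) q $ j"
    and "pd_v (pd_u Y) q $ k = f2 (Y q $ i) * pd_u Y q $ i * pd_v Y q $ i
      + f1 (Y q $ i) * pd_v (pd_u Y) q $ i
      + g2 (Y q $ j) * pd_u Y q $ j * pd_v Y q $ j + g1 (Y q $ j) * pd_v (pd_u Y) q $ j"
    and "pd_v (pd_v Y) q $ k = f2 (Y q $ i) * pd_v Y q $ i * pd_v Y q $ i
      + f1 (Y q $ i) * pd_v (pd_v Y) q $ i
      + g2 (Y q $ j) * pd_v Y q $ j * pd_v Y q $ j + g1 (Y q $ j) * pd_v (pd_v Y) q $ j"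
proof -
  have b: "(1, 0) \<in> (Basis :: (real \<times> real) set)" "(0, 1) \<in> (Basis :: (real \<times> real) set)"
    by (auto simp: Basis_prod_def)
  show "pd_u (pd_u Y) q $ k = f2 (Y q $ i) * pd_u Y q $ i * pd_u Y q $ i
      + f1 (Y q $ i) * pd_u (pd_u Y) q $ i
      + g2 (Y q $ j) * pd_u Y q $ j * pd_u Y q $ j + g1 (Y q $ j) * pd_u (pd_u Y) q $ j"
    using second_derivative_graph[OF assms b(1), of "(1, 0)"] unfolding pd_u_def pd_v_def .
  show "pd_v (pd_u Y) q $ k = f2 (Y q $ i) * pd_u Y q $ i * pd_v Y q $ i
      + f1 (Y q $ i) * pd_v (pd_u Y) q $ i
      + g2 (Y q $ j) * pd_u Y q $ j * pd_v Y q $ j + g1 (Y q $ j) * pd_v (pd_u Y) q $ j"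
    using second_derivative_graph[OF assms b(1), of "(0, 1)"] unfolding pd_u_def pd_v_def .
  show "pd_v (pd_v Y) q $ k = f2 (Y q $ i) * pd_v Y q $ i * pd_v Y q $ i
      + f1 (Y q $ i) * pd_v (pd_v Y) q $ i
      + g2 (Y q $ j) * pd_v Y q $ j * pd_v Y q $ j + g1 (Y q $ j) * pd_v (pd_v Y) q $ j"
    using second_derivative_graph[OF assms b(2), of "(0, 1)"] unfolding pd_u_def pd_v_def .
qed

text \<open>By the differentiated graph equation, the \<open>k\<close>-th component of a tangent
  vector is determined by the other two. Projection to the \<open>i\<close>, \<open>j\<close> plane
  therefore loses nothing, and injectivity survives it.\<close>

lemma projected_jacobian_nonzero:
  assumes q: "q \<in> V" and inj: "inj (frechet_derivative Y (at q))"
  shows "pd_u Y q $ i * pd_v Y q $ j - pd_u Y q $ j * pd_v Y q $ i \<noteq> 0" (is "?d \<noteq> 0")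
proof
  assume d: "?d = 0"
  let ?L = "frechet_derivative Y (at q)"
  have lin: "linear ?L" by (rule linear_frechet_derivative[OF smooth_onD[OF smooth q]])
  have L: "?L (x, y) = x *\<^sub>R pd_u Y q + y *\<^sub>R pd_v Y q" for x y
    using linear_add[OF lin, of "x *\<^sub>R (1, 0)" "y *\<^sub>R (0, 1)"]
    by (simp add: linear_scale[OF lin, of x "(1, 0)", simplified]
        linear_scale[OF lin, of y "(0, 1)", simplified] pd_u_def pd_v_def)
  have zero: "(x, y) = 0" if "?L (x, y) $ i = 0" "?L (x, y) $ j = 0" for x y
  proof -
    have "?L (x, y) $ k = 0" using that frechet_derivative_graph[OF q, of "(x, y)"] by simp
    then have "?L (x, y) $ m = 0" for m using that axes_cases[OF axes] by (metis UNIV_I insertE singletonD)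
    then have "?L (x, y) = ?L 0" using linear_0[OF lin] by (simp add: vec_eq_iff)
    then show ?thesis using inj by (simp add: inj_eq)
  qed
  \<comment> \<open>If the determinant is zero, both rows of the Jacobian, turned by a right angle,
    lie in its kernel. They must vanish, so the Jacobian is zero and kills \<open>(1, 0)\<close> as
    well.\<close>
  have "(pd_v Y q $ i, - (pd_u Y q $ i)) = 0" using d by (intro zero) (simp_all add: L algebra_simps)
  moreover have "(pd_v Y q $ j, - (pd_u Y q $ j)) = 0" using d by (intro zero) (simp_all add: L algebra_simps)
  ultimately have "(1, 0) = (0 :: real \<times> real)" by (intro zero) (simp_all add: L zero_prod_def)
  then show False by (simp add: zero_prod_def)
qed

text \<open>Orthogonality to the tangent plane expresses \<open>n\<close> through its
  \<open>k\<close>-th component. Numerators and denominators of both curvatures then carry the same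
  factor \<open>d\<^sup>2\<close>, the squared Jacobian of the change to graph coordinates, and it
  cancels.\<close>

lemma curvatures_graph:
  assumes q: "q \<in> V" and inj: "inj (frechet_derivative Y (at q))"
    and n: "\<forall>w\<in>tangent_plane Y q. lorentz n w = 0" "\<bar>lorentz n n\<bar> = 1"
  shows "(n $ k)\<^sup>2 * \<bar>graph_det i j k (f1 (Y q $ i)) (g1 (Y q $ j))\<bar> = 1"
    and "param_mean_curvature \<epsilon> Y n q = graph_mean_curvature i j k \<epsilon> (n $ k)
      (f1 (Y q $ i)) (g1 (Y q $ j)) (f2 (Y q $ i)) (g2 (Y q $ j))"
    and "param_gauss_curvature \<epsilon> Y n q = graph_gauss_curvature i j k \<epsilon> (n $ k)
      (f1 (Y q $ i)) (g1 (Y q $ j)) (f2 (Y q $ i)) (g2 (Y q $ j))"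
proof -
  note pd = pd_k[OF q] and pdpd = pd_pd_k[OF q]
  let ?p = "f1 (Y q $ i)" and ?q = "g1 (Y q $ j)" and ?x = "f2 (Y q $ i)" and ?y = "g2 (Y q $ j)"
  define d where "d = pd_u Y q $ i * pd_v Y q $ j - pd_u Y q $ j * pd_v Y q $ i"
  have d: "d \<noteq> 0" unfolding d_def by (rule projected_jacobian_nonzero[OF q inj])
  define si where "si = lorentz_sign i"
  define sj where "sj = lorentz_sign j"
  define sk where "sk = lorentz_sign k"
  note sgn = si_def sj_def sk_def
  define W where "W = si * sj + sk * (si * ?q\<^sup>2 + sj * ?p\<^sup>2)"
  note L = lorentz_axes[OF axes, folded sgn]
  have sq: "si\<^sup>2 = 1" "sj\<^sup>2 = 1" "sk\<^sup>2 = 1" and pr: "si * sj * sk = -1"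
    unfolding sgn by (rule lorentz_sign_sq)+ (rule lorentz_sign_prod[OF axes])
  have "lorentz n (pd_u Y q) = 0" "lorentz n (pd_v Y q) = 0"
    using n(1) unfolding tangent_plane_def pd_u_def pd_v_def by blast+
  then have u: "(si * n $ i + sk * n $ k * ?p) * pd_u Y q $ i + (sj * n $ j + sk * n $ k * ?q) * pd_u Y q $ j = 0"
    and v: "(si * n $ i + sk * n $ k * ?p) * pd_v Y q $ i + (sj * n $ j + sk * n $ k * ?q) * pd_v Y q $ j = 0"
    by (simp_all add: L pd algebra_simps)
  \<comment> \<open>Cramer's rule for the homogeneous system \<open>u\<close>, \<open>v\<close>,
    whose determinant is \<open>d\<close>.\<close>
  have "(si * n $ i + sk * n $ k * ?p) * d = 0" "(sj * n $ j + sk * n $ k * ?q) * d = 0"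
    using u v unfolding d_def by algebra+
  then have ni: "si * n $ i = - (sk * n $ k * ?p)" and nj: "sj * n $ j = - (sk * n $ k * ?q)"
    using d by auto
  have W: "graph_det i j k ?p ?q = W" by (simp add: graph_det_def W_def sgn)
  \<comment> \<open>The product of the three signs being -1 turns \<open>W\<close> into
    \<open>- (sk + si * ?p\<^sup>2 + sj * ?q\<^sup>2)\<close>.\<close>
  have "lorentz n n = - ((n $ k)\<^sup>2 * W)"
    unfolding L W_def using ni nj sq pr by algebra
  then show "(n $ k)\<^sup>2 * \<bar>graph_det i j k ?p ?q\<bar> = 1" using n(2) by (simp add: abs_mult W)
  then have W0: "W \<noteq> 0" by (auto simp: W)
  \<comment> \<open>In this form the second derivatives of \<open>Y $ i\<close> and
    \<open>Y $ j\<close> cancel, and only the terms with \<open>f''\<close> and \<open>g''\<close>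
    remain.\<close>
  have LL: "lorentz n w = sk * n $ k * (w $ k - ?p * w $ i - ?q * w $ j)" for w
    unfolding L using ni nj by algebra
  have l: "lorentz n (pd_u (pd_u Y) q) = sk * n $ k * (?x * (pd_u Y q $ i)\<^sup>2 + ?y * (pd_u Y q $ j)\<^sup>2)"
    and m: "lorentz n (pd_v (pd_u Y) q) = sk * n $ k * (?x * pd_u Y q $ i * pd_v Y q $ i + ?y * pd_u Y q $ j * pd_v Y q $ j)"
    and r: "lorentz n (pd_v (pd_v Y) q) = sk * n $ k * (?x * (pd_v Y q $ i)\<^sup>2 + ?y * (pd_v Y q $ j)\<^sup>2)"
    by (simp_all add: LL pdpd power2_eq_square)
  let ?E = "lorentz (pd_u Y q) (pd_u Y q)" and ?F = "lorentz (pd_u Y q) (pd_v Y q)"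
    and ?G = "lorentz (pd_v Y q) (pd_v Y q)"
  \<comment> \<open>\<open>W\<close> is the value of \<open>EG - F\<^sup>2\<close> for the
    parametrization of the graph by its two base coordinates.\<close>
  have det: "?E * ?G - ?F\<^sup>2 = W * d\<^sup>2"
    unfolding L pd d_def W_def by algebra
  have tr: "lorentz n (pd_u (pd_u Y) q) * ?G - 2 * lorentz n (pd_v (pd_u Y) q) * ?F
      + lorentz n (pd_v (pd_v Y) q) * ?E
      = sk * n $ k * (?x * (sj + sk * ?q\<^sup>2) + ?y * (si + sk * ?p\<^sup>2)) * d\<^sup>2"
    unfolding l m r unfolding L pd d_def by algebra
  have ga: "lorentz n (pd_u (pd_u Y) q) * lorentz n (pd_v (pd_v Y) q) - (lorentz n (pd_v (pd_u Y) q))\<^sup>2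
      = (n $ k)\<^sup>2 * ?x * ?y * d\<^sup>2"
    unfolding l m r d_def using sq(3) by algebra
  show "param_mean_curvature \<epsilon> Y n q = graph_mean_curvature i j k \<epsilon> (n $ k)
      (f1 (Y q $ i)) (g1 (Y q $ j)) (f2 (Y q $ i)) (g2 (Y q $ j))"
    unfolding param_mean_curvature_def graph_mean_curvature_def Let_def det tr W
    unfolding sgn[symmetric] using d by simp
  show "param_gauss_curvature \<epsilon> Y n q = graph_gauss_curvature i j k \<epsilon> (n $ k)
      (f1 (Y q $ i)) (g1 (Y q $ j)) (f2 (Y q $ i)) (g2 (Y q $ j))"
    unfolding param_gauss_curvature_def graph_gauss_curvature_def Let_def det ga W
    using d by simp
qed

end

section \<open>Curvatures of the surface in a translation chart\<close>

text \<open>Shrinks a second parametrization to a neighbourhood that stays inside the first chart,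
  where the graph equation is available.\<close>

lemma local_param_transition_domain:
  assumes "local_param S \<psi> U \<phi>" "local_param S \<psi> U' \<phi>'" "z \<in> U'" "\<phi>' z \<in> \<phi> ` U"
  obtains V where "open V" "z \<in> V" "V \<subseteq> U'" "\<phi>' ` V \<subseteq> \<phi> ` U"
proof -
  have "continuous_map (top_of_set U') S \<phi>'" and U': "open U'" and "openin S (\<phi> ` U)"
    using assms(1,2) by (auto simp: local_param_def embedding_map_def intro: homeomorphic_imp_continuous_map
        continuous_map_into_fulltopology)
  then have "openin (top_of_set U') {x \<in> U'. \<phi>' x \<in> \<phi> ` U}"
    using openin_continuous_map_preimage by fastforce
  then have "open {x \<in> U'. \<phi>' x \<in> \<phi> ` U}" using U' openin_open_eq by blast
  then show ?thesis using assms(3,4) by (intro that[of "{x \<in> U'. \<phi>' x \<in> \<phi> ` U}"]) auto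
qed

lemma translation_chart_curvatures:
  assumes N: "unit_normal_field S \<psi> N" and \<phi>: "local_param S \<psi> (I \<times> J) \<phi>" and axes: "distinct [i, j, k]"
    and graph: "\<And>s t. s \<in> I \<Longrightarrow> t \<in> J \<Longrightarrow>
      \<psi> (\<phi> (s, t)) $ i = s \<and> \<psi> (\<phi> (s, t)) $ j = t \<and> \<psi> (\<phi> (s, t)) $ k = f s + g t"
    and f1: "\<And>x. x \<in> I \<Longrightarrow> (f has_real_derivative f1 x) (at x)"
    and f2: "\<And>x. x \<in> I \<Longrightarrow> (f1 has_real_derivative f2 x) (at x)"
    and g1: "\<And>x. x \<in> J \<Longrightarrow> (g has_real_derivative g1 x) (at x)"
    and g2: "\<And>x. x \<in> J \<Longrightarrow> (g1 has_real_derivative g2 x) (at x)"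
    and st: "s \<in> I" "t \<in> J"
  defines "n \<equiv> N (\<phi> (s, t)) $ k"
  shows "n\<^sup>2 * \<bar>graph_det i j k (f1 s) (g1 t)\<bar> = 1"
    and "mean_curvature S \<psi> N (\<phi> (s, t))
      = graph_mean_curvature i j k (causal_sign S \<psi>) n (f1 s) (g1 t) (f2 s) (g2 t)"
    and "gauss_curvature S \<psi> N (\<phi> (s, t))
      = graph_gauss_curvature i j k (causal_sign S \<psi>) n (f1 s) (g1 t) (f2 s) (g2 t)"
proof -
  let ?p = "\<phi> (s, t)"
  have p: "?p \<in> \<phi> ` (I \<times> J)" using st by blast
  have "\<phi> ` (I \<times> J) \<subseteq> topspace S" using \<phi> openin_subset unfolding local_param_def by blast
  then have norm: "\<bar>lorentz (N ?p) (N ?p)\<bar> = 1" using N p unfolding unit_normal_field_def by blast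
  \<comment> \<open>The right-hand sides do not involve \<open>\<phi>'\<close>, so all
    parametrizations through the point give the same values. This is the existence half of both
    definite descriptions.\<close>
  have all: "n\<^sup>2 * \<bar>graph_det i j k (f1 s) (g1 t)\<bar> = 1 \<and>
    param_mean_curvature \<epsilon> (\<psi> \<circ> \<phi>') (N ?p) q = graph_mean_curvature i j k \<epsilon> n (f1 s) (g1 t) (f2 s) (g2 t) \<and>
    param_gauss_curvature \<epsilon> (\<psi> \<circ> \<phi>') (N ?p) q = graph_gauss_curvature i j k \<epsilon> n (f1 s) (g1 t) (f2 s) (g2 t)"
    if \<phi>': "local_param S \<psi> U \<phi>'" "q \<in> U" "\<phi>' q = ?p" for U \<phi>' q \<epsilon>
  proof -
    let ?Y = "\<psi> \<circ> \<phi>'"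
    obtain V where V: "open V" "q \<in> V" "V \<subseteq> U" "\<phi>' ` V \<subseteq> \<phi> ` (I \<times> J)"
      using local_param_transition_domain[OF \<phi> \<phi>'(1,2)] p \<phi>'(3) by auto
    have sm: "smooth_on V ?Y" using \<phi>'(1) V(3) smooth_on_subset unfolding local_param_def by blast
    have Y: "?Y z $ i \<in> I \<and> ?Y z $ j \<in> J \<and> ?Y z $ k = f (?Y z $ i) + g (?Y z $ j)" if z: "z \<in> V" for z
    proof -
      have "\<phi>' z \<in> \<phi> ` (I \<times> J)" using V(4) z by blast
      then obtain s' t' where "s' \<in> I" "t' \<in> J" "\<phi>' z = \<phi> (s', t')" by auto
      then show ?thesis using graph[of s' t'] by simp
    qed
    interpret G: graph_near i j k V ?Y I J f f1 f2 g g1 g2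
      by unfold_locales (use Y in \<open>blast intro: axes V(1) sm f1 f2 g1 g2\<close>)+
    have inj: "inj (frechet_derivative ?Y (at q))" using \<phi>'(1,2) unfolding local_param_def by blast
    have tan: "\<forall>w\<in>tangent_plane ?Y q. lorentz (N ?p) w = 0"
      using N \<phi>' unfolding unit_normal_field_def by metis
    show ?thesis
      using G.curvatures_graph(1)[OF V(2) inj tan norm] G.curvatures_graph(2,3)[OF V(2) inj tan norm, of \<epsilon>]
        graph[OF st] by (simp add: \<phi>'(3) n_def)
  qed
  show "n\<^sup>2 * \<bar>graph_det i j k (f1 s) (g1 t)\<bar> = 1" using all[OF \<phi>, of "(s, t)"] st by blast
  show "mean_curvature S \<psi> N ?p
      = graph_mean_curvature i j k (causal_sign S \<psi>) n (f1 s) (g1 t) (f2 s) (g2 t)"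
    unfolding mean_curvature_def
  proof (rule the_equality)
    \<comment> \<open>Uniqueness: the translation chart itself is one of the competing
      parametrizations.\<close>
    fix h assume "\<forall>U \<phi>' q. local_param S \<psi> U \<phi>' \<and> q \<in> U \<and> \<phi>' q = ?p \<longrightarrow>
        h = param_mean_curvature (causal_sign S \<psi>) (\<psi> \<circ> \<phi>') (N ?p) q"
    then have "h = param_mean_curvature (causal_sign S \<psi>) (\<psi> \<circ> \<phi>) (N ?p) (s, t)" using \<phi> st by blast
    then show "h = graph_mean_curvature i j k (causal_sign S \<psi>) n (f1 s) (g1 t) (f2 s) (g2 t)"
      using all[OF \<phi>, of "(s, t)"] st by simp
  qed (blast intro: all[THEN conjunct2, THEN conjunct1, symmetric])
  show "gauss_curvature S \<psi> N ?p
      = graph_gauss_curvature i j k (causal_sign S \<psi>) n (f1 s) (g1 t) (f2 s) (g2 t)"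
    unfolding gauss_curvature_def
  proof (rule the_equality)
    fix h assume "\<forall>U \<phi>' q. local_param S \<psi> U \<phi>' \<and> q \<in> U \<and> \<phi>' q = ?p \<longrightarrow>
        h = param_gauss_curvature (causal_sign S \<psi>) (\<psi> \<circ> \<phi>') (N ?p) q"
    then have "h = param_gauss_curvature (causal_sign S \<psi>) (\<psi> \<circ> \<phi>) (N ?p) (s, t)" using \<phi> st by blast
    then show "h = graph_gauss_curvature i j k (causal_sign S \<psi>) n (f1 s) (g1 t) (f2 s) (g2 t)"
      using all[OF \<phi>, of "(s, t)"] st by simp
  qed (blast intro: all[THEN conjunct2, THEN conjunct2, symmetric])
qed

section \<open>Flatness from the Weingarten relation\<close>

text \<open>Produces the shape required by \<open>no_separated_relation\<close>, with
  \<open>R = 1 / n\<close>, \<open>P = lorentz_sign i / x\<close> and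
  \<open>Q = lorentz_sign j / y\<close>. The normalization of \<open>n\<close> makes
  \<open>R\<^sup>2\<close> the absolute value of the determinant, and a fixed sign \<open>d\<close>
  makes this affine in \<open>X\<close> and \<open>Y\<close>.\<close>

lemma weingarten_relation:
  fixes a b c \<epsilon> n p q x y d :: real and i j k :: 3
  defines "X \<equiv> - lorentz_sign i * lorentz_sign k * p\<^sup>2" and "Y \<equiv> - lorentz_sign j * lorentz_sign k * q\<^sup>2"
  assumes n: "n\<^sup>2 * \<bar>graph_det i j k p q\<bar> = 1"
    and d: "\<bar>graph_det i j k p q\<bar> = d * graph_det i j k p q"
    and eq: "a * graph_mean_curvature i j k \<epsilon> n p q x y + b * graph_gauss_curvature i j k \<epsilon> n p q x y = c"
    and xy: "x \<noteq> 0" "y \<noteq> 0"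
  shows "(1 / n)\<^sup>2 = d * lorentz_sign i * lorentz_sign j * (1 - X - Y)"
    and "(a * \<epsilon> * lorentz_sign k / 2) * (1 / n) * ((1 - X) * (lorentz_sign i / x) + (1 - Y) * (lorentz_sign j / y))
      = - b * \<epsilon> + c * d * lorentz_sign i * lorentz_sign j * (1 - X - Y)\<^sup>2 * (lorentz_sign i / x) * (lorentz_sign j / y)"
proof -
  define si where "si = lorentz_sign i"
  define sj where "sj = lorentz_sign j"
  define sk where "sk = lorentz_sign k"
  note sgn = si_def sj_def sk_def
  define D where "D = graph_det i j k p q"
  have sq: "si\<^sup>2 = 1" "sj\<^sup>2 = 1" "sk\<^sup>2 = 1" unfolding sgn by (rule lorentz_sign_sq)+
  have Deq: "D = si * sj * (1 - X - Y)"
    unfolding D_def graph_det_def X_def Y_def sgn[symmetric] using sq by algebra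
  have n0: "n \<noteq> 0" and D0: "D \<noteq> 0" using n by (auto simp: D_def)
  have nd: "n\<^sup>2 * (d * D) = 1" using n d by (simp add: D_def)
  define R where "R = 1 / n"
  define u where "u = 1 / x"
  define v where "v = 1 / y"
  have inv: "R * n = 1" "u * x = 1" "v * y = 1" using n0 xy by (simp_all add: R_def u_def v_def)
  have R2: "R\<^sup>2 = d * D" using nd inv(1) by algebra
  then show "(1 / n)\<^sup>2 = d * lorentz_sign i * lorentz_sign j * (1 - X - Y)"
    by (simp add: R_def Deq sgn)
  have "a * (\<epsilon> * (1/2) * (sk * n * (x * (sj + sk * q\<^sup>2) + y * (si + sk * p\<^sup>2)) / D))
      + b * (\<epsilon> * (n\<^sup>2 * x * y / D)) = c"
    using eq unfolding graph_mean_curvature_def graph_gauss_curvature_def sgn D_def by simp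
  then have "a * \<epsilon> * sk / 2 * n * (x * (sj + sk * q\<^sup>2) + y * (si + sk * p\<^sup>2)) + b * \<epsilon> * n\<^sup>2 * x * y = c * D"
    using D0 by (simp add: field_simps)
  moreover have "sj + sk * q\<^sup>2 = sj * (1 - Y)" "si + sk * p\<^sup>2 = si * (1 - X)"
    unfolding X_def Y_def sgn[symmetric] using sq by algebra+
  ultimately have e: "a * \<epsilon> * sk / 2 * n * (x * (sj * (1 - Y)) + y * (si * (1 - X))) + b * \<epsilon> * n\<^sup>2 * x * y = c * D"
    by simp
  define A where "A = a * \<epsilon> * sk / 2"
  \<comment> \<open>This is \<open>e\<close> multiplied by \<open>R\<^sup>2 * u * v\<close>.\<close>
  have "A * R * ((1 - X) * (si * u) + (1 - Y) * (sj * v)) + b * \<epsilon> = c * D * R\<^sup>2 * u * v"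
    using e[folded A_def] inv by algebra
  also have "\<dots> = c * d * si * sj * (1 - X - Y)\<^sup>2 * (si * u) * (sj * v)"
    unfolding R2 Deq by algebra
  finally show "(a * \<epsilon> * lorentz_sign k / 2) * (1 / n) * ((1 - X) * (lorentz_sign i / x) + (1 - Y) * (lorentz_sign j / y))
      = - b * \<epsilon> + c * d * lorentz_sign i * lorentz_sign j * (1 - X - Y)\<^sup>2 * (lorentz_sign i / x) * (lorentz_sign j / y)"
    by (simp add: A_def R_def u_def v_def sgn)
qed

text \<open>Rolle's theorem makes \<open>h\<close> injective, and each value of the scaled square
  comes from at most two values of \<open>h\<close>.\<close>

lemma infinite_image_scaled_square:
  fixes h :: "real \<Rightarrow> real"
  assumes "l < u" "\<kappa> \<noteq> 0" and h: "\<And>x. x \<in> {l<..<u} \<Longrightarrow> (h has_real_derivative h' x) (at x) \<and> h' x \<noteq> 0"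
  shows "infinite ((\<lambda>x. \<kappa> * (h x)\<^sup>2) ` {l<..<u})"
proof
  assume fin: "finite ((\<lambda>x. \<kappa> * (h x)\<^sup>2) ` {l<..<u})" (is "finite ?F")
  have "h x \<noteq> h y" if "x \<in> {l<..<u}" "y \<in> {l<..<u}" "x < y" for x y
  proof
    assume "h x = h y"
    moreover have "isCont h z" if "z \<in> {x..y}" for z
      using h[of z] that \<open>x \<in> _\<close> \<open>y \<in> _\<close> by (auto intro: DERIV_isCont)
    then have "continuous_on {x..y} h" by (simp add: continuous_at_imp_continuous_on)
    moreover have "h differentiable (at z)" if "x < z" "z < y" for z
      using h[of z] that \<open>x \<in> _\<close> \<open>y \<in> _\<close> by (auto simp: real_differentiable_def)
    ultimately obtain z where "x < z" "z < y" "DERIV h z :> 0" using Rolle[of x y h] \<open>x < y\<close> by blast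
    then show False using h[of z] \<open>x \<in> _\<close> \<open>y \<in> _\<close> DERIV_unique[of h 0 z "h' z"] by auto
  qed
  then have "inj_on h {l<..<u}" by (metis inj_onI linorder_neqE_linordered_idom)
  moreover have "infinite {l<..<u}" using assms(1) by simp
  ultimately have "infinite (h ` {l<..<u})" using finite_imageD by blast
  moreover have "h ` {l<..<u} \<subseteq> (\<Union>w\<in>?F. {sqrt (w / \<kappa>), - sqrt (w / \<kappa>)})"
  proof
    fix z assume "z \<in> h ` {l<..<u}"
    then have "\<kappa> * z\<^sup>2 \<in> ?F" by blast
    moreover have "z = sqrt (\<kappa> * z\<^sup>2 / \<kappa>) \<or> z = - sqrt (\<kappa> * z\<^sup>2 / \<kappa>)" using assms(2) by auto
    ultimately show "z \<in> (\<Union>w\<in>?F. {sqrt (w / \<kappa>), - sqrt (w / \<kappa>)})" by blast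
  qed
  ultimately show False using fin by (meson finite.intros finite_UN_I finite_subset)
qed

text \<open>If both second derivatives were nonzero at the point, they would stay so on a rectangle
  around it. There \<open>X\<close> takes infinitely many values and \<open>Y\<close> two distinct
  nonzero ones, against \<open>no_separated_relation\<close>.\<close>

lemma graph_linear_weingarten_flat:
  assumes I: "open I" "open J"
    and f2: "\<And>x. x \<in> I \<Longrightarrow> (f1 has_real_derivative f2 x) (at x)" and cf: "continuous_on I f2"
    and g2: "\<And>x. x \<in> J \<Longrightarrow> (g1 has_real_derivative g2 x) (at x)" and cg: "continuous_on J g2"
    and n: "\<And>s t. s \<in> I \<Longrightarrow> t \<in> J \<Longrightarrow> (n s t)\<^sup>2 * \<bar>graph_det i j k (f1 s) (g1 t)\<bar> = 1"
    and eq: "\<And>s t. s \<in> I \<Longrightarrow> t \<in> J \<Longrightarrow>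
      a * graph_mean_curvature i j k \<epsilon> (n s t) (f1 s) (g1 t) (f2 s) (g2 t)
      + b * graph_gauss_curvature i j k \<epsilon> (n s t) (f1 s) (g1 t) (f2 s) (g2 t) = c"
    and nz: "a \<noteq> 0" "b \<noteq> 0" "\<epsilon> \<noteq> 0" and st: "s0 \<in> I" "t0 \<in> J"
  shows "f2 s0 = 0 \<or> g2 t0 = 0"
proof (rule ccontr)
  assume "\<not> ?thesis"
  then have f20: "f2 s0 \<noteq> 0" and g20: "g2 t0 \<noteq> 0" by auto
  define D where "D s t = graph_det i j k (f1 s) (g1 t)" for s t
  have sn: "lorentz_sign m \<noteq> 0" for m by (simp add: lorentz_sign_def)
  have D0: "D s t \<noteq> 0" if "s \<in> I" "t \<in> J" for s t using n[OF that] by (auto simp: D_def)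
  \<comment> \<open>A positive product means that \<open>D\<close> keeps the sign it has at
    \<open>(s0, t0)\<close>, so that one number \<open>d\<close> serves all nearby points.\<close>
  have lim: "((\<lambda>z. D (fst z) (snd z) * D s0 t0) \<longlongrightarrow> D s0 t0 * D s0 t0) (nhds (s0, t0))"
  proof -
    have "(f1 \<longlongrightarrow> f1 s0) (nhds s0)" "(g1 \<longlongrightarrow> g1 t0) (nhds t0)"
      using DERIV_isCont[OF f2[OF st(1)]] DERIV_isCont[OF g2[OF st(2)]]
      by (simp_all add: isCont_def tendsto_at_iff_tendsto_nhds)
    moreover have "filterlim fst (nhds s0) (nhds (s0, t0))" "filterlim snd (nhds t0) (nhds (s0, t0))"
      by (auto simp: nhds_prod filterlim_fst filterlim_snd)
    ultimately have "((\<lambda>z. f1 (fst z)) \<longlongrightarrow> f1 s0) (nhds (s0, t0))" "((\<lambda>z. g1 (snd z)) \<longlongrightarrow> g1 t0) (nhds (s0, t0))"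
      using filterlim_compose by blast+
    then show ?thesis unfolding D_def graph_det_def by (intro tendsto_intros)
  qed
  have "eventually (\<lambda>z. 0 < D (fst z) (snd z) * D s0 t0) (nhds (s0, t0))"
    using order_tendstoD(1)[OF lim, of 0] D0[OF st] by (metis not_real_square_gt_zero)
  \<comment> \<open>The product filter splits the condition into one on \<open>s\<close> and one on
    \<open>t\<close>, which yields a rectangle.\<close>
  then obtain Pf Pg where Pf: "eventually Pf (nhds s0)" and Pg: "eventually Pg (nhds t0)"
    and P: "\<And>s t. Pf s \<Longrightarrow> Pg t \<Longrightarrow> 0 < D s t * D s0 t0"
    unfolding nhds_prod eventually_prod_filter by auto
  have near: "eventually (\<lambda>x. h x \<noteq> 0) (nhds x0)" if "continuous_on K h" "open K" "x0 \<in> K" "h x0 \<noteq> 0"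
    for h :: "real \<Rightarrow> real" and K x0
  proof -
    have "isCont h x0" using that continuous_on_eq_continuous_at by blast
    then have "(h \<longlongrightarrow> h x0) (nhds x0)" by (simp add: isCont_def tendsto_at_iff_tendsto_nhds)
    then show ?thesis using that(4) by (rule tendsto_imp_eventually_ne)
  qed
  have "eventually (\<lambda>s. Pf s \<and> s \<in> I \<and> f2 s \<noteq> 0) (nhds s0)"
    using Pf near[OF cf I(1) st(1) f20] eventually_nhds_in_open[OF I(1) st(1)] by eventually_elim auto
  then obtain e where e: "e > 0" "\<And>s. dist s s0 < e \<Longrightarrow> Pf s \<and> s \<in> I \<and> f2 s \<noteq> 0"
    unfolding eventually_nhds_metric by blast
  have "eventually (\<lambda>t. Pg t \<and> t \<in> J \<and> g2 t \<noteq> 0) (nhds t0)"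
    using Pg near[OF cg I(2) st(2) g20] eventually_nhds_in_open[OF I(2) st(2)] by eventually_elim auto
  then obtain e' where e': "e' > 0" "\<And>t. dist t t0 < e' \<Longrightarrow> Pg t \<and> t \<in> J \<and> g2 t \<noteq> 0"
    unfolding eventually_nhds_metric by blast
  define X where "X s = - lorentz_sign i * lorentz_sign k * (f1 s)\<^sup>2" for s
  define Y where "Y t = - lorentz_sign j * lorentz_sign k * (g1 t)\<^sup>2" for t
  let ?I = "{s0 - e<..<s0 + e}" and ?J = "{t0 - e'<..<t0 + e'}"
  have eI: "Pf s \<and> s \<in> I \<and> f2 s \<noteq> 0" if "s \<in> ?I" for s using that by (intro e(2)) (auto simp: dist_real_def)
  have eJ: "Pg t \<and> t \<in> J \<and> g2 t \<noteq> 0" if "t \<in> ?J" for t using that by (intro e'(2)) (auto simp: dist_real_def)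
  have infX: "infinite (X ` ?I)"
    unfolding X_def using e(1) eI f2 sn by (intro infinite_image_scaled_square) auto
  have infY: "infinite (Y ` ?J)"
    unfolding Y_def using e'(1) eJ g2 sn by (intro infinite_image_scaled_square) auto
  have "infinite (Y ` ?J - {0})" using infY by simp
  then obtain t1 where t1: "t1 \<in> ?J" "Y t1 \<noteq> 0" using infinite_imp_nonempty by blast
  have "infinite (Y ` ?J - {0, Y t1})" using infY by simp
  then obtain t2 where t2: "t2 \<in> ?J" "Y t2 \<noteq> 0" "Y t2 \<noteq> Y t1" using infinite_imp_nonempty by blast
  define d where "d = sgn (D s0 t0)"
  have d: "\<bar>graph_det i j k (f1 s) (g1 t)\<bar> = d * graph_det i j k (f1 s) (g1 t)" if "s \<in> ?I" "t \<in> ?J" for s t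
    using P[of s t] eI[OF that(1)] eJ[OF that(2)] unfolding d_def D_def[symmetric]
    by (auto simp: zero_less_mult_iff)
  have "Y t1 = Y t2"
  proof (rule no_separated_relation[OF infX])
    show "a * \<epsilon> * lorentz_sign k / 2 \<noteq> 0" "- b * \<epsilon> \<noteq> 0" "d * lorentz_sign i * lorentz_sign j \<noteq> 0"
      "Y t1 \<noteq> 0" "Y t2 \<noteq> 0"
      using nz sn t1 t2 D0[OF st] by (simp_all add: d_def sgn_eq_0_iff)
    fix x assume "x \<in> X ` ?I"
    then obtain s where s: "s \<in> ?I" "x = X s" by blast
    have I: "s \<in> I" "f2 s \<noteq> 0" using eI[OF s(1)] by auto
    \<comment> \<open>The witness \<open>P = lorentz_sign i / f2 s\<close> depends on
      \<open>s\<close> alone and so is common to \<open>t1\<close> and \<open>t2\<close>; the roots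
      are \<open>1 / n s t1\<close> and \<open>1 / n s t2\<close>.\<close>
    note rel = weingarten_relation[OF n[OF I(1)] d[OF s(1)] eq[OF I(1)] I(2), folded X_def Y_def s(2)]
    show "\<exists>P R1 R2. R1\<^sup>2 = d * lorentz_sign i * lorentz_sign j * (1 - x - Y t1) \<and>
        R2\<^sup>2 = d * lorentz_sign i * lorentz_sign j * (1 - x - Y t2) \<and>
        a * \<epsilon> * lorentz_sign k / 2 * R1 * ((1 - x) * P + (1 - Y t1) * (lorentz_sign j / g2 t1))
          = - b * \<epsilon> + c * d * lorentz_sign i * lorentz_sign j * (1 - x - Y t1)\<^sup>2 * P * (lorentz_sign j / g2 t1) \<and>
        a * \<epsilon> * lorentz_sign k / 2 * R2 * ((1 - x) * P + (1 - Y t2) * (lorentz_sign j / g2 t2))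
          = - b * \<epsilon> + c * d * lorentz_sign i * lorentz_sign j * (1 - x - Y t2)\<^sup>2 * P * (lorentz_sign j / g2 t2)"
    proof (intro exI conjI)
      show "(1 / n s t1)\<^sup>2 = d * lorentz_sign i * lorentz_sign j * (1 - x - Y t1)"
        "(1 / n s t2)\<^sup>2 = d * lorentz_sign i * lorentz_sign j * (1 - x - Y t2)"
        using eJ t1(1) t2(1) by (auto intro: rel(1))
    qed (use eJ t1(1) t2(1) rel(2) in blast)+
  qed
  then show False using t2(3) by simp
qed

section \<open>Case distinction on the coefficients\<close>

theorem theorem2:
  fixes S :: "'m topology" and \<psi> N :: "'m \<Rightarrow> real^3"
  assumes "immersed_surface S \<psi>"
    and "nondegenerate S \<psi>"
    and "translation_surface S \<psi>"
    and "unit_normal_field S \<psi> N"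
    and "linear_weingarten S \<psi> N"
  shows "gauss_curvature S \<psi> N constant_on topspace S \<or> mean_curvature S \<psi> N constant_on topspace S"
proof -
  obtain a b c :: real where abc: "\<not> (a = 0 \<and> b = 0 \<and> c = 0)"
    and lw: "\<And>p. p \<in> topspace S \<Longrightarrow> a * mean_curvature S \<psi> N p + b * gauss_curvature S \<psi> N p = c"
    using assms(5) unfolding linear_weingarten_def by blast
  consider "a = 0" "b = 0" | "a = 0" "b \<noteq> 0" | "a \<noteq> 0" "b = 0" | "a \<noteq> 0" "b \<noteq> 0" by blast
  then show ?thesis
  proof cases
    case 1
    \<comment> \<open>Here \<open>c\<close> is nonzero and the relation reads \<open>0 = c\<close>,
      so the surface has no points.\<close>
    then have "p \<notin> topspace S" for p using abc lw[of p] by auto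
    then show ?thesis unfolding constant_on_def by blast
  next
    case 2
    then have "gauss_curvature S \<psi> N p = c / b" if "p \<in> topspace S" for p
      using lw[OF that] by (simp add: field_simps)
    then show ?thesis unfolding constant_on_def by blast
  next
    case 3
    then have "mean_curvature S \<psi> N p = c / a" if "p \<in> topspace S" for p
      using lw[OF that] by (simp add: field_simps)
    then show ?thesis unfolding constant_on_def by blast
  next
    case 4
    \<comment> \<open>The constant is zero at every point, so charts over different coordinate
      planes need no comparison.\<close>
    have "gauss_curvature S \<psi> N p = 0" if p: "p \<in> topspace S" for p
    proof -
      obtain I J f g \<phi> where IJ: "open I" "open J" and fg: "smooth_on I f" "smooth_on J g"
        and \<phi>: "local_param S \<psi> (I \<times> J) \<phi>" "p \<in> \<phi> ` (I \<times> J)"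
        and graph: "(\<forall>s\<in>I. \<forall>t\<in>J. \<psi> (\<phi> (s, t)) = vector [s, t, f s + g t]) \<or>
         (\<forall>s\<in>I. \<forall>t\<in>J. \<psi> (\<phi> (s, t)) = vector [s, f s + g t, t]) \<or>
         (\<forall>s\<in>I. \<forall>t\<in>J. \<psi> (\<phi> (s, t)) = vector [f s + g t, s, t])"
        using assms(3) p unfolding translation_surface_def by metis
      \<comment> \<open>\<open>i\<close> and \<open>j\<close> are the axes of the base plane, and
        \<open>k\<close> is the axis of the graph direction.\<close>
      obtain i j k where axes: "distinct [i, j, k]" and gr: "\<And>s t. s \<in> I \<Longrightarrow> t \<in> J \<Longrightarrow>
          \<psi> (\<phi> (s, t)) $ i = s \<and> \<psi> (\<phi> (s, t)) $ j = t \<and> \<psi> (\<phi> (s, t)) $ k = f s + g t"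
        using graph
      proof (elim disjE)
        assume "\<forall>s\<in>I. \<forall>t\<in>J. \<psi> (\<phi> (s, t)) = vector [s, t, f s + g t]"
        then show ?thesis by (intro that[of 1 2 3]) simp_all
      next
        assume "\<forall>s\<in>I. \<forall>t\<in>J. \<psi> (\<phi> (s, t)) = vector [s, f s + g t, t]"
        then show ?thesis by (intro that[of 1 3 2]) simp_all
      next
        assume "\<forall>s\<in>I. \<forall>t\<in>J. \<psi> (\<phi> (s, t)) = vector [f s + g t, s, t]"
        then show ?thesis by (intro that[of 2 3 1]) simp_all
      qed
      obtain f1 f2 where f: "\<And>x. x \<in> I \<Longrightarrow> (f has_real_derivative f1 x) (at x)"
        "\<And>x. x \<in> I \<Longrightarrow> (f1 has_real_derivative f2 x) (at x)" "continuous_on I f2"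
        by (rule smooth_on_real_derivatives[OF fg(1)]) (rule that)
      obtain g1 g2 where g: "\<And>x. x \<in> J \<Longrightarrow> (g has_real_derivative g1 x) (at x)"
        "\<And>x. x \<in> J \<Longrightarrow> (g1 has_real_derivative g2 x) (at x)" "continuous_on J g2"
        by (rule smooth_on_real_derivatives[OF fg(2)]) (rule that)
      have cur: "(N (\<phi> (s, t)) $ k)\<^sup>2 * \<bar>graph_det i j k (f1 s) (g1 t)\<bar> = 1"
        "mean_curvature S \<psi> N (\<phi> (s, t)) = graph_mean_curvature i j k (causal_sign S \<psi>)
          (N (\<phi> (s, t)) $ k) (f1 s) (g1 t) (f2 s) (g2 t)"
        "gauss_curvature S \<psi> N (\<phi> (s, t)) = graph_gauss_curvature i j k (causal_sign S \<psi>)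
          (N (\<phi> (s, t)) $ k) (f1 s) (g1 t) (f2 s) (g2 t)"
        if "s \<in> I" "t \<in> J" for s t
        by (rule translation_chart_curvatures[OF assms(4) \<phi>(1) axes, where f = f and g = g];
            use gr f(1,2) g(1,2) that in blast)+
      have top: "\<phi> (s, t) \<in> topspace S" if "s \<in> I" "t \<in> J" for s t
        using \<phi>(1) that openin_subset unfolding local_param_def by blast
      obtain s t where st: "s \<in> I" "t \<in> J" "p = \<phi> (s, t)" using \<phi>(2) by blast
      have "f2 s = 0 \<or> g2 t = 0"
      proof (rule graph_linear_weingarten_flat[where I = I and J = J and n = "\<lambda>s t. N (\<phi> (s, t)) $ k" and
            i = i and j = j and k = k and a = a and b = b and c = c and
            ?f1.0 = f1 and ?f2.0 = f2 and ?g1.0 = g1 and ?g2.0 = g2 and \<epsilon> = "causal_sign S \<psi>"])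
        show "(N (\<phi> (s, t)) $ k)\<^sup>2 * \<bar>graph_det i j k (f1 s) (g1 t)\<bar> = 1" if "s \<in> I" "t \<in> J" for s t
          by (rule cur(1)[OF that])
        show "a * graph_mean_curvature i j k (causal_sign S \<psi>) (N (\<phi> (s, t)) $ k) (f1 s) (g1 t) (f2 s) (g2 t)
          + b * graph_gauss_curvature i j k (causal_sign S \<psi>) (N (\<phi> (s, t)) $ k) (f1 s) (g1 t) (f2 s) (g2 t) = c"
          if "s \<in> I" "t \<in> J" for s t
          using lw[OF top[OF that]] by (simp only: cur(2,3)[OF that])
        show "causal_sign S \<psi> \<noteq> 0" by (simp add: causal_sign_def)
      qed (fact IJ f g 4 st)+
      \<comment> \<open>The Gauss curvature has the factor \<open>f2 s * g2 t\<close>.\<close>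
      then show ?thesis using cur(3)[OF st(1,2)] by (auto simp: st(3) graph_gauss_curvature_def)
    qed
    then show ?thesis unfolding constant_on_def by blast
  qed
qed

end
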